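(* There is an absolute constant $C$ such that every finite Sidon set $\mathcal{A}$ with $k$ elements satisfies \[ \operatorname{diam}(\mathcal{A})\ge k^2-1.99058\,k^{3/2}-Ck. \]
   Context: A Sidon set is a set $\mathcal{A}$ of integers such that the only solutions of $a-b=c-d$ with $a,b,c,d\in\mathcal{A}$ are the trivial ones ($a=b,c=d$ or $a=c,b=d$). For a finite set $\mathcal{A}$, $\operatorname{diam}(\mathcal{A})=\max\mathcal{A}-\min\mathcal{A}$. *)

theory Defs
  imports "HOL-Analysis.Analysis"
begin

definition sidon :: "int set \<Rightarrow> bool" where
  "sidon A \<longleftrightarrow>
     (\<forall>a\<in>A. \<forall>b\<in>A. \<forall>c\<in>A. \<forall>d\<in>A.
        a - b = c - d \<longrightarrow> (a = b \<and> c = d) \<or> (a = c \<and> b = d))"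

(* Meaningful only for finite nonempty sets, since Max and Min are unspecified otherwise. *)
definition diam :: "int set \<Rightarrow> int" where
  "diam A = Max A - Min A"

end

theory Submission
  imports Defs
begin

text \<open>
  Let \<open>n\<close> be the diameter and count the elements of \<open>A\<close> in all windows of length \<open>T\<close>. The Sidon
  property bounds the second moment of these counts, so their squared deviation from \<open>T / k\<close> is at
  most \<open>k T - T\<^sup>2 + T\<^sup>2 (n + T) / k\<^sup>2\<close>. Windows that reach beyond the first or the last element
  of \<open>A\<close> by more than \<open>T - m\<close> have counts that do not depend on \<open>T \<ge> m\<close>. Taking both \<open>T = m\<close> and
  \<open>T = 2 m\<close>, with \<open>m\<close> about \<open>k powr (3/2) / 2\<close>, the same \<open>2 m\<close> counts have to be close to
  both \<open>m / k\<close> and \<open>2 m / k\<close> in mean square, which is impossible if \<open>n\<close> is too small.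
\<close>

section \<open>Window counts and their moments\<close>

text \<open>This is the number of elements of \<open>A\<close> in the interval from
  \<open>j - T + 1\<close> to \<open>j\<close>. Indexing by the right end makes
  \<open>{lo..<hi + T}\<close> exactly the positions whose window meets \<open>{lo..hi}\<close>, for
  \<open>T > 0\<close> and \<open>lo \<le> hi\<close>. Real values allow deviations from a
  non-integral mean.\<close>

definition window :: "int set \<Rightarrow> int \<Rightarrow> int \<Rightarrow> real" where
  "window A T j = (\<Sum>a\<in>A. of_bool (a \<le> j \<and> j < a + T))"

lemma sum_window:
  assumes "A \<subseteq> {lo..hi}" "T \<ge> 0"
  shows "(\<Sum>j\<in>{lo..<hi + T}. window A T j) = real (card A) * T"
proof -
  have "(\<Sum>j\<in>{lo..<hi + T}. of_bool (a \<le> j \<and> j < a + T)) = real_of_int T" if "a \<in> A" for a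
  proof -
    have "{lo..<hi + T} \<inter> {j. a \<le> j \<and> j < a + T} = {a..<a + T}"
      using assms that by force
    then show ?thesis using \<open>T \<ge> 0\<close> by simp
  qed
  then show ?thesis
    unfolding window_def by (subst sum.swap) simp
qed

lemma sum_window_pair:
  fixes a b T :: int
  assumes "a \<in> {lo..hi}" "b \<in> {lo..hi}"
  shows "(\<Sum>j\<in>{lo..<hi + T}. of_bool (a \<le> j \<and> j < a + T) * of_bool (b \<le> j \<and> j < b + T))
    = real_of_int (max 0 (T - \<bar>a - b\<bar>))"
proof -
  have "(\<Sum>j\<in>{lo..<hi + T}. of_bool (a \<le> j \<and> j < a + T) * of_bool (b \<le> j \<and> j < b + T))
    = (\<Sum>j\<in>{lo..<hi + T}. of_bool (max a b \<le> j \<and> j < min a b + T) :: real)"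
    by (intro sum.cong) auto
  also have "{lo..<hi + T} \<inter> {j. max a b \<le> j \<and> j < min a b + T} = {max a b..<min a b + T}"
    using assms by auto
  then have "(\<Sum>j\<in>{lo..<hi + T}. of_bool (max a b \<le> j \<and> j < min a b + T) :: real)
    = real (nat (min a b + T - max a b))"
    by simp
  also have "\<dots> = real_of_int (max 0 (T - \<bar>a - b\<bar>))"
    by (auto simp: max_def min_def)
  finally show ?thesis .
qed

lemma sum_triangle: "(\<Sum>d\<in>{- int n..int n}. int n - \<bar>d\<bar>) = (int n)\<^sup>2"
proof (induction n)
  case (Suc n)
  have "{- int (Suc n)..int (Suc n)} = insert (int (Suc n)) (insert (- int (Suc n)) {- int n..int n})"
    by auto
  \<comment> \<open>The two new endpoints contribute 0, and each of the \<open>2 * n + 1\<close> old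
    terms grows by 1.\<close>
  then have "(\<Sum>d\<in>{- int (Suc n)..int (Suc n)}. int (Suc n) - \<bar>d\<bar>)
      = (\<Sum>d\<in>{- int n..int n}. (int n - \<bar>d\<bar>) + 1)"
    by (simp add: algebra_simps)
  also have "\<dots> = (int n)\<^sup>2 + (2 * int n + 1)"
    unfolding sum.distrib Suc by simp
  finally show ?case by (simp add: power2_eq_square algebra_simps)
qed simp

text \<open>The diagonal pairs give \<open>card A * T\<close>. Off the diagonal, the Sidon property
  makes \<open>(a, b)\<close> recoverable from \<open>a - b\<close>, so each difference
  \<open>d\<close> occurs at most once and these pairs give at most the full triangle sum
  \<open>T\<^sup>2\<close>.\<close>

lemma sidon_sum_triangle_le:
  assumes "finite A" "sidon A" "T \<ge> 0"
  shows "(\<Sum>a\<in>A. \<Sum>b\<in>A. max 0 (T - \<bar>a - b\<bar>)) \<le> int (card A) * T + T\<^sup>2"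
proof -
  define h where "h d = max 0 (T - \<bar>d\<bar>)" for d :: int
  define P where "P = {p \<in> A \<times> A. fst p \<noteq> snd p}"
  define Q where "Q = {p \<in> P. \<bar>fst p - snd p\<bar> \<le> T}"
  have fin: "finite P" unfolding P_def using assms by auto
  have inj: "inj_on (\<lambda>p. fst p - snd p) Q"
    using \<open>sidon A\<close> unfolding inj_on_def Q_def P_def sidon_def by auto
  have "(\<Sum>a\<in>A. \<Sum>b\<in>A. h (a - b)) = (\<Sum>p\<in>A \<times> A. h (fst p - snd p))"
    by (simp add: sum.cartesian_product case_prod_beta)
  also have "A \<times> A = (\<lambda>a. (a, a)) ` A \<union> P" unfolding P_def by auto
  also have "(\<Sum>p\<in>\<dots>. h (fst p - snd p))
      = (\<Sum>p\<in>(\<lambda>a. (a, a)) ` A. h (fst p - snd p)) + (\<Sum>p\<in>P. h (fst p - snd p))"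
    by (rule sum.union_disjoint) (use assms fin in \<open>auto simp: P_def\<close>)
  also have "(\<Sum>p\<in>(\<lambda>a. (a, a)) ` A. h (fst p - snd p)) = int (card A) * T"
    using \<open>T \<ge> 0\<close> by (subst sum.reindex) (auto simp: inj_on_def h_def)
  also have "(\<Sum>p\<in>P. h (fst p - snd p)) = (\<Sum>p\<in>Q. h (fst p - snd p))"
    by (rule sum.mono_neutral_right) (auto simp: fin Q_def h_def)
  also have "\<dots> = sum h ((\<lambda>p. fst p - snd p) ` Q)"
    using inj by (simp add: sum.reindex)
  also have "\<dots> \<le> sum h {-T..T}"
    by (rule sum_mono2) (auto simp: Q_def h_def)
  also have "\<dots> = (\<Sum>d\<in>{-T..T}. T - \<bar>d\<bar>)"
    by (rule sum.cong) (auto simp: h_def)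
  also have "\<dots> = T\<^sup>2"
    using sum_triangle[of "nat T"] \<open>T \<ge> 0\<close> by simp
  finally show ?thesis by (simp add: h_def)
qed

lemma sidon_sum_window_power2_le:
  assumes "finite A" "sidon A" "A \<subseteq> {lo..hi}" "T \<ge> 0"
  shows "(\<Sum>j\<in>{lo..<hi + T}. (window A T j)\<^sup>2) \<le> real (card A) * T + (real_of_int T)\<^sup>2"
proof -
  let ?w = "\<lambda>a j. of_bool (a \<le> j \<and> j < a + T) :: real"
  have "(\<Sum>j\<in>{lo..<hi + T}. (window A T j)\<^sup>2)
      = (\<Sum>j\<in>{lo..<hi + T}. \<Sum>a\<in>A. \<Sum>b\<in>A. ?w a j * ?w b j)"
    unfolding window_def power2_eq_square sum_product ..
  also have "\<dots> = (\<Sum>a\<in>A. \<Sum>j\<in>{lo..<hi + T}. \<Sum>b\<in>A. ?w a j * ?w b j)"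
    by (rule sum.swap)
  also have "\<dots> = (\<Sum>a\<in>A. \<Sum>b\<in>A. \<Sum>j\<in>{lo..<hi + T}. ?w a j * ?w b j)"
    by (intro sum.cong refl sum.swap)
  also have "\<dots> = (\<Sum>a\<in>A. \<Sum>b\<in>A. real_of_int (max 0 (T - \<bar>a - b\<bar>)))"
    using assms by (intro sum.cong refl sum_window_pair) auto
  also have "\<dots> = real_of_int (\<Sum>a\<in>A. \<Sum>b\<in>A. max 0 (T - \<bar>a - b\<bar>))"
    by simp
  also have "\<dots> \<le> real_of_int (int (card A) * T + T\<^sup>2)"
    using sidon_sum_triangle_le[OF assms(1,2,4)] by (simp only: of_int_le_iff)
  finally show ?thesis by simp
qed

text \<open>Expand the square and insert both moments; there are \<open>hi - lo + T\<close> windows.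
  The centre \<open>c\<close> stays free: it is taken as \<open>T / card A\<close> in the main
  estimate and as \<open>card A / 2\<close> in the crude bound on the diameter.\<close>

lemma sidon_window_deviation_le:
  fixes c :: real
  assumes "finite A" "sidon A" "A \<subseteq> {lo..hi}" "lo \<le> hi" "T \<ge> 0"
  shows "(\<Sum>j\<in>{lo..<hi + T}. (window A T j - c)\<^sup>2)
    \<le> real (card A) * T + (real_of_int T)\<^sup>2 - 2 * c * real (card A) * T + c\<^sup>2 * (hi - lo + T)"
proof -
  have "(\<Sum>j\<in>{lo..<hi + T}. (window A T j - c)\<^sup>2)
      = (\<Sum>j\<in>{lo..<hi + T}. (window A T j)\<^sup>2 - 2 * c * window A T j + c\<^sup>2)"
    by (intro sum.cong) (auto simp: power2_eq_square algebra_simps)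
  also have "\<dots> = (\<Sum>j\<in>{lo..<hi + T}. (window A T j)\<^sup>2)
      - 2 * c * (\<Sum>j\<in>{lo..<hi + T}. window A T j) + c\<^sup>2 * (hi - lo + T)"
    using assms by (simp add: sum.distrib sum_subtractf sum_distrib_left algebra_simps)
  finally show ?thesis
    using sidon_sum_window_power2_le[OF assms(1,2,3,5)] sum_window[OF assms(3,5)] by simp
qed

section \<open>Windows at the two edges of the set\<close>

text \<open>Either window starts at or before \<open>lo\<close>, so both count the elements of
  \<open>A\<close> up to \<open>lo + i\<close>. Symmetrically, the windows of
  \<open>window_right\<close> start at \<open>hi - i\<close> and end at or after
  \<open>hi\<close>.\<close>

lemma window_left:
  assumes "A \<subseteq> {lo..hi}" "0 \<le> i" "i < m" "m \<le> T"
  shows "window A T (lo + i) = window A m (lo + i)"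
  unfolding window_def using assms by (intro sum.cong refl arg_cong[where f = of_bool]) force

lemma window_right:
  assumes "A \<subseteq> {lo..hi}" "0 \<le> i" "i < m" "m \<le> T"
  shows "window A T (hi + T - 1 - i) = window A m (hi + m - 1 - i)"
  unfolding window_def using assms by (intro sum.cong refl arg_cong[where f = of_bool]) force

lemma edge_deviation_le:
  fixes c :: real
  assumes "A \<subseteq> {lo..hi}" "m \<le> T" "m \<le> hi - lo"
  shows "(\<Sum>i\<in>{0..<m}. (window A m (lo + i) - c)\<^sup>2)
      + (\<Sum>i\<in>{0..<m}. (window A m (hi + m - 1 - i) - c)\<^sup>2)
    \<le> (\<Sum>j\<in>{lo..<hi + T}. (window A T j - c)\<^sup>2)"
proof -
  let ?g = "\<lambda>j. (window A T j - c)\<^sup>2"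
  let ?L = "(\<lambda>i. lo + i) ` {0..<m}" and ?R = "(\<lambda>i. hi + T - 1 - i) ` {0..<m}"
  have "(\<Sum>i\<in>{0..<m}. (window A m (lo + i) - c)\<^sup>2) = (\<Sum>i\<in>{0..<m}. ?g (lo + i))"
    using assms(2) by (intro sum.cong refl) (simp add: window_left[OF assms(1), of _ m T])
  also have "\<dots> = sum ?g ?L"
    by (subst sum.reindex) (auto simp: inj_on_def)
  finally have L: "(\<Sum>i\<in>{0..<m}. (window A m (lo + i) - c)\<^sup>2) = sum ?g ?L" .
  have "(\<Sum>i\<in>{0..<m}. (window A m (hi + m - 1 - i) - c)\<^sup>2) = (\<Sum>i\<in>{0..<m}. ?g (hi + T - 1 - i))"
    using assms(2) by (intro sum.cong refl) (simp add: window_right[OF assms(1), of _ m T])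
  also have "\<dots> = sum ?g ?R"
    by (subst sum.reindex) (auto simp: inj_on_def)
  finally have R: "(\<Sum>i\<in>{0..<m}. (window A m (hi + m - 1 - i) - c)\<^sup>2) = sum ?g ?R" .
  \<comment> \<open>The two edges are disjoint since \<open>lo + m - 1 < hi + T - m\<close>, by
    \<open>m \<le> hi - lo\<close> and \<open>m \<le> T\<close>.\<close>
  have "sum ?g ?L + sum ?g ?R = sum ?g (?L \<union> ?R)"
    by (rule sum.union_disjoint[symmetric]) (use assms in auto)
  also have "\<dots> \<le> sum ?g {lo..<hi + T}"
    by (rule sum_mono2) (use assms in auto)
  finally show ?thesis unfolding L R .
qed

text \<open>This secures the disjointness of the two edges. If the diameter were below
  \<open>m\<close>, fewer than \<open>2 * m\<close> windows would share the total count
  \<open>card A * m\<close>; their mean would exceed \<open>card A / 2\<close>, too much for the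
  second moment bound.\<close>

lemma sidon_half_window_le_diam:
  fixes lo hi m :: int
  assumes "finite A" "sidon A" "A \<subseteq> {lo..hi}" "lo \<le> hi" "m > 0"
    and "2 * (real (card A) + m) < (real (card A))\<^sup>2"
  shows "m \<le> hi - lo"
proof (rule ccontr)
  assume "\<not> m \<le> hi - lo"
  let ?k = "real (card A)"
  have "0 \<le> (\<Sum>j\<in>{lo..<hi + m}. (window A m j - ?k / 2)\<^sup>2)"
    by (intro sum_nonneg) simp
  also have "\<dots> \<le> ?k * m + (real_of_int m)\<^sup>2 - 2 * (?k / 2) * ?k * m + (?k / 2)\<^sup>2 * (hi - lo + m)"
    using sidon_window_deviation_le[of A lo hi m "?k / 2"] assms by simp
  also have "(?k / 2)\<^sup>2 * (hi - lo + m) \<le> (?k / 2)\<^sup>2 * (2 * m)"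
    using \<open>\<not> m \<le> hi - lo\<close> by (intro mult_left_mono) auto
  finally have "0 \<le> m * (?k + m - ?k\<^sup>2 / 2)"
    by (simp add: power2_eq_square field_simps)
  moreover have "m * (?k + m - ?k\<^sup>2 / 2) < 0"
    using assms by (intro mult_pos_neg) auto
  ultimately show False by simp
qed

section \<open>Comparing two window lengths\<close>

lemma deviation_combine:
  fixes x y z l :: real
  assumes "l > 0"
  shows "(y - z)\<^sup>2 \<le> (1 + l) * (x - y)\<^sup>2 + (1 + 1 / l) * (x - z)\<^sup>2"
proof -
  \<comment> \<open>The slack in this weighted triangle inequality is a perfect square divided by
    \<open>l\<close>.\<close>
  have "l * ((1 + l) * (x - y)\<^sup>2 + (1 + 1 / l) * (x - z)\<^sup>2 - (y - z)\<^sup>2)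
      = (l * (x - y) + (x - z))\<^sup>2"
    using assms by (simp add: power2_eq_square field_simps)
  then have "0 \<le> l * ((1 + l) * (x - y)\<^sup>2 + (1 + 1 / l) * (x - z)\<^sup>2 - (y - z)\<^sup>2)"
    by simp
  then show ?thesis using assms by (simp add: zero_le_mult_iff)
qed

text \<open>The same \<open>2 * m\<close> edge counts are compared with \<open>c\<close> as part of
  the windows of length \<open>m\<close>, and with \<open>d\<close> as part of those of length
  \<open>T\<close>. The weight \<open>l\<close> balances the two errors.\<close>

lemma sidon_two_scales:
  fixes c d l k :: real and lo hi m T :: int
  assumes "finite A" "sidon A" "A \<subseteq> {lo..hi}" "0 \<le> m" "m \<le> hi - lo" "m \<le> T" "l > 0"
  defines "k \<equiv> real (card A)"
  shows "2 * m * (c - d)\<^sup>2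
    \<le> (1 + l) * (k * m + (real_of_int m)\<^sup>2 - 2 * c * k * m + c\<^sup>2 * (hi - lo + m))
      + (1 + 1 / l) * (k * T + (real_of_int T)\<^sup>2 - 2 * d * k * T + d\<^sup>2 * (hi - lo + T))"
    (is "_ \<le> (1 + l) * ?X + (1 + 1 / l) * ?Y")
proof -
  define L where "L i = window A m (lo + i)" for i
  define R where "R i = window A m (hi + m - 1 - i)" for i
  define E where "E e = (\<Sum>i\<in>{0..<m}. (L i - e)\<^sup>2) + (\<Sum>i\<in>{0..<m}. (R i - e)\<^sup>2)" for e
  have "2 * m * (c - d)\<^sup>2 = (\<Sum>i\<in>{0..<m}. (c - d)\<^sup>2) + (\<Sum>i\<in>{0..<m}. (c - d)\<^sup>2)"
    using \<open>0 \<le> m\<close> by simp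
  also have "\<dots> \<le> (\<Sum>i\<in>{0..<m}. (1 + l) * (L i - c)\<^sup>2 + (1 + 1 / l) * (L i - d)\<^sup>2)
      + (\<Sum>i\<in>{0..<m}. (1 + l) * (R i - c)\<^sup>2 + (1 + 1 / l) * (R i - d)\<^sup>2)"
    using \<open>l > 0\<close> by (intro add_mono sum_mono deviation_combine)
  also have "\<dots> = (1 + l) * E c + (1 + 1 / l) * E d"
    unfolding E_def sum.distrib sum_distrib_left[symmetric] by (simp only: distrib_left ac_simps)
  finally have *: "2 * m * (c - d)\<^sup>2 \<le> (1 + l) * E c + (1 + 1 / l) * E d" .
  have "E c \<le> ?X"
    unfolding E_def L_def R_def k_def
    by (rule order_trans[OF edge_deviation_le sidon_window_deviation_le]) (use assms in auto)
  moreover have "E d \<le> ?Y"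
    unfolding E_def L_def R_def k_def
    by (rule order_trans[OF edge_deviation_le sidon_window_deviation_le]) (use assms in auto)
  ultimately have "(1 + l) * E c + (1 + 1 / l) * E d \<le> (1 + l) * ?X + (1 + 1 / l) * ?Y"
    using \<open>l > 0\<close> by (intro add_mono mult_left_mono) auto
  with * show ?thesis by (rule order_trans)
qed

text \<open>This is the final contradiction after division by \<open>s ^ 5 * t\<close>, for weight
  \<open>l = 0.3\<close>: \<open>1 + l = 1.3\<close>, and \<open>26 / 3\<close> is
  \<open>1 + 1 / l = 13 / 3\<close> times the factor 2 from the doubled length.\<close>

lemma two_scales_numeric:
  fixes t :: real
  assumes "0.49 \<le> t" "t \<le> 0.5"
  shows "1.3 * (1 - 1.99058 * t + t\<^sup>2) + 26 / 3 * (1 - 2 * 1.99058 * t + 4 * t\<^sup>2) < 2 * t\<^sup>2"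
proof -
  \<comment> \<open>Collected on one side, the quadratic is convex in \<open>t\<close>, so
    \<open>t\<^sup>2\<close> may be replaced by its chord over the interval, leaving a linear
    inequality.\<close>
  have "(t - 0.49) * (t - 0.5) \<le> 0"
    using assms by (intro mult_nonneg_nonpos) auto
  moreover have "(t - 0.49) * (t - 0.5) = t\<^sup>2 - 0.99 * t + 0.245"
    by (simp add: power2_eq_square field_simps)
  ultimately have "t\<^sup>2 \<le> 0.99 * t - 0.245" by simp
  then show ?thesis using assms by (simp add: field_simps)
qed

lemma sidon_diam_large:
  fixes lo hi :: int and s :: real
  assumes "finite A" "sidon A" "A \<subseteq> {lo..hi}" "lo \<le> hi" "card A \<ge> 25"
  defines "s \<equiv> sqrt (real (card A))"
  shows "s ^ 4 - 1.99058 * s ^ 3 \<le> hi - lo"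
proof (rule ccontr)
  assume neg: "\<not> ?thesis"
  define m where "m = \<lfloor>s ^ 3 / 2\<rfloor>"
  define t where "t = m / s ^ 3"
  have k: "real (card A) = s\<^sup>2" by (simp add: s_def)
  have s5: "s \<ge> 5"
    unfolding s_def using \<open>card A \<ge> 25\<close> by (intro real_le_rsqrt) simp
  then have s3: "s ^ 3 \<ge> 125" using power_mono[of 5 s 3] by simp
  have m_eq: "real_of_int m = t * s ^ 3" using s5 by (simp add: t_def)
  have m_le: "m \<le> s ^ 3 / 2" and m_ge: "m > s ^ 3 / 2 - 1" unfolding m_def by linarith+
  have m_pos: "m > 0" using m_ge s3 by linarith
  \<comment> \<open>Rounding down costs less than \<open>1 / s ^ 3\<close>, which is at most
    \<open>1 / 125\<close>.\<close>
  have "t \<le> 0.5" "0.49 \<le> t"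
    using m_le m_ge s3 s5 by (simp_all add: t_def field_simps)
  note numeric = two_scales_numeric[OF this(2,1)]
  have "m \<le> hi - lo"
  proof (rule sidon_half_window_le_diam[OF assms(1-4) m_pos])
    have "2 * (s\<^sup>2 + m) \<le> s\<^sup>2 * (2 + s)"
      using m_le by (simp add: power2_eq_square power3_eq_cube algebra_simps)
    also have "\<dots> < s\<^sup>2 * s\<^sup>2"
    proof (rule mult_strict_left_mono)
      have "s * 5 \<le> s * s" using s5 by (intro mult_left_mono) auto
      then show "2 + s < s\<^sup>2" using s5 unfolding power2_eq_square by linarith
    qed (use s5 in auto)
    finally show "2 * (real (card A) + m) < (real (card A))\<^sup>2"
      unfolding k by (simp add: power2_eq_square)
  qed
  \<comment> \<open>This bounds the deviation for length \<open>q * s ^ 3\<close> and mean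
    \<open>q * s\<close>, to be used with \<open>q = t\<close> and \<open>q = 2 * t\<close>. The
    terms of order \<open>s ^ 6\<close> cancel, so the \<open>s ^ 3\<close> term of the assumed
    diameter bound decides.\<close>
  have bound: "s\<^sup>2 * (q * s ^ 3) + (q * s ^ 3)\<^sup>2 - 2 * (q * s) * s\<^sup>2 * (q * s ^ 3)
      + (q * s)\<^sup>2 * (hi - lo + q * s ^ 3) \<le> s ^ 5 * q * (1 - 1.99058 * q + q\<^sup>2)" for q
  proof -
    have "(q * s)\<^sup>2 * (hi - lo + q * s ^ 3) \<le> (q * s)\<^sup>2 * (s ^ 4 - 1.99058 * s ^ 3 + q * s ^ 3)"
      using neg by (intro mult_left_mono) auto
    then show ?thesis by (simp add: power_numeral_reduce algebra_simps)
  qed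
  have "2 * (t * s ^ 3) * (t * s - 2 * t * s)\<^sup>2
      \<le> 1.3 * (s\<^sup>2 * (t * s ^ 3) + (t * s ^ 3)\<^sup>2 - 2 * (t * s) * s\<^sup>2 * (t * s ^ 3)
            + (t * s)\<^sup>2 * (hi - lo + t * s ^ 3))
        + 13 / 3 * (s\<^sup>2 * (2 * t * s ^ 3) + (2 * t * s ^ 3)\<^sup>2
            - 2 * (2 * t * s) * s\<^sup>2 * (2 * t * s ^ 3) + (2 * t * s)\<^sup>2 * (hi - lo + 2 * t * s ^ 3))"
    using sidon_two_scales[OF assms(1-3), of m "2 * m" "0.3" "t * s" "2 * t * s"]
      m_pos \<open>m \<le> hi - lo\<close> unfolding k by (simp add: m_eq mult.assoc)
  also have "\<dots> \<le> 1.3 * (s ^ 5 * t * (1 - 1.99058 * t + t\<^sup>2))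
      + 13 / 3 * (s ^ 5 * (2 * t) * (1 - 1.99058 * (2 * t) + (2 * t)\<^sup>2))"
    by (intro add_mono mult_left_mono bound) auto
  also have "\<dots> = s ^ 5 * t * (1.3 * (1 - 1.99058 * t + t\<^sup>2)
      + 26 / 3 * (1 - 2 * 1.99058 * t + 4 * t\<^sup>2))"
    by (simp add: power2_eq_square field_simps)
  also have "\<dots> < s ^ 5 * t * (2 * t\<^sup>2)"
    using numeric s5 \<open>0.49 \<le> t\<close> by (intro mult_strict_left_mono mult_pos_pos) auto
  also have "\<dots> = 2 * (t * s ^ 3) * (t * s - 2 * t * s)\<^sup>2"
    by (simp add: power_numeral_reduce algebra_simps)
  finally show False by simp
qed

theorem theorem2:
  shows "\<exists>C::real. \<forall>(k::nat) (A::int set).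
           finite A \<and> A \<noteq> {} \<and> sidon A \<and> card A = k \<longrightarrow>
             real_of_int (diam A)
               \<ge> (real k)\<^sup>2 - 1.99058 * (real k powr (3/2)) - C * real k"
proof (intro exI[of _ 25] allI impI, elim conjE)
  fix k :: nat and A :: "int set"
  assume A: "finite A" "A \<noteq> {}" "sidon A" and k: "card A = k"
  have le: "Min A \<le> Max A" and sub: "A \<subseteq> {Min A..Max A}" using A by auto
  show "(real k)\<^sup>2 - 1.99058 * (real k powr (3/2)) - 25 * real k \<le> real_of_int (diam A)"
  proof (cases "k \<ge> 25")
    case True
    have "real k powr (3/2) = sqrt (real k) ^ 3"
      using True by (simp add: powr_half_sqrt[symmetric] powr_powr flip: powr_numeral)
    moreover have "sqrt (real k) ^ 4 = (real k)\<^sup>2"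
      using power_mult[of "sqrt (real k)" 2 2] by simp
    ultimately show ?thesis
      using sidon_diam_large[OF A(1,3) sub le] True k by (simp add: diam_def)
  next
    case False
    \<comment> \<open>For \<open>k < 25\<close> the linear term makes the lower bound nonpositive;
      the constant 25 matches the threshold of \<open>sidon_diam_large\<close>.\<close>
    then have "real k * real k \<le> 25 * real k" by (intro mult_right_mono) auto
    moreover have "0 \<le> real_of_int (diam A)" using le by (simp add: diam_def)
    moreover have "0 \<le> 1.99058 * (real k powr (3/2))" by simp
    ultimately show ?thesis unfolding power2_eq_square by linarith
  qed
qed

end
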